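(* Let $k$ be a number field and $m\geq n\geq1$ integers. There are exactly $n$ double cosets in $P_{mn-1,1}(k)\backslash\mathrm{GL}_{mn}(k)/T_{m,n}(k)$, and the elements $$\varepsilon_r=\begin{pmatrix}I_{(m-r)n-1}&&\\&&I_{rn}\\&1&\end{pmatrix}\begin{pmatrix}I_{(m-r)n-1}&0&0\\&1&\underline{b_r}\\&&I_{rn}\end{pmatrix},\qquad 0\leq r\leq n-1,$$ with $\underline{b_r}=(e_{n-1}^T,e_{n-2}^T,\dots,e_{n-r}^T)\in k^{rn}$, form a set of representatives.
   Context: $P_{mn-1,1}$ is the parabolic subgroup of $\mathrm{GL}_{mn}$ of matrices $\begin{pmatrix}A&X\\0&d\end{pmatrix}$ with $A\in\mathrm{GL}_{mn-1}$, $d\in\mathrm{GL}_1$. For $h=(h_{ij})\in\mathrm{GL}_m(k)$, $g\in\mathrm{GL}_n(k)$, the Kronecker product $t(h,g)$ is the $mn\times mn$ block matrix whose $(i,j)$ block is $h_{ij}g$, and $T_{m,n}(k)=\{t(h,g)\}$ is its image. $e_1,\dots,e_n$ is the standard column basis of $k^n$ (so $e_i^T$ are row vectors); for $r=0$, $\varepsilon_0=I_{mn}$. *)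

theory Defs
  imports
    "Jordan_Normal_Form.Matrix"
    "HOL-Algebra.Coset"
begin

definition number_field :: "'k :: field_char_0 itself \<Rightarrow> bool" where
  "number_field _ \<longleftrightarrow>
     (\<exists>B :: 'k set. finite B \<and> module.span (\<lambda>q x. of_rat q * x) B = UNIV)"

text \<open>The constant \<^const>\<open>module.span\<close> above has its intended meaning:\<close>
lemma vector_space_of_rat: "vector_space (\<lambda>q x :: 'k :: field_char_0. of_rat q * x)"
  by unfold_locales (simp_all add: algebra_simps of_rat_add of_rat_mult)

definition GL :: "nat \<Rightarrow> 'k :: field mat monoid" where
  "GL n = units_of (ring_mat TYPE('k) n ())"

definition parabolic :: "nat \<Rightarrow> nat \<Rightarrow> 'k :: field mat set" where
  "parabolic p q = {four_block_mat A X (0\<^sub>m q p) D | A X D.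
     A \<in> carrier (GL p) \<and> X \<in> carrier_mat p q \<and> D \<in> carrier (GL q)}"

definition kronecker :: "'k :: field mat \<Rightarrow> 'k mat \<Rightarrow> 'k mat" where
  "kronecker h g = mat (dim_row h * dim_row g) (dim_col h * dim_col g)
     (\<lambda>(i, j). h $$ (i div dim_row g, j div dim_col g) * g $$ (i mod dim_row g, j mod dim_col g))"

definition kronecker_subgroup :: "nat \<Rightarrow> nat \<Rightarrow> 'k :: field mat set" where
  "kronecker_subgroup m n = {kronecker h g | h g. h \<in> carrier (GL m) \<and> g \<in> carrier (GL n)}"

definition double_coset ::
    "('a, 'b) monoid_scheme \<Rightarrow> 'a set \<Rightarrow> 'a set \<Rightarrow> 'a \<Rightarrow> 'a set" where
  "double_coset G H K x = (H #>\<^bsub>G\<^esub> x) <#>\<^bsub>G\<^esub> K"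

definition double_cosets ::
    "('a, 'b) monoid_scheme \<Rightarrow> 'a set \<Rightarrow> 'a set \<Rightarrow> 'a set set" where
  "double_cosets G H K = double_coset G H K ` carrier G"

text \<open>
  Column \<open>j\<close> of \<open>b\<^sub>r = (e\<^sub>n\<^sub>-\<^sub>1\<^sup>T, \<dots>, e\<^sub>n\<^sub>-\<^sub>r\<^sup>T)\<close>, counted from \<open>0\<close>, lies in the block
  \<open>e\<^sub>n\<^sub>-\<^sub>s\<^sup>T\<close> with \<open>s = j div n + 1\<close>. The vector \<open>e\<^sub>i\<close> of the 1-based standard basis is
  \<open>unit_vec n (i - 1)\<close>.
\<close>
definition b_row :: "nat \<Rightarrow> nat \<Rightarrow> 'k :: field mat" where
  "b_row n r = mat 1 (r * n)
     (\<lambda>(_, j). unit_vec n (n - (j div n + 1) - 1) $ (j mod n))"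

definition eps :: "nat \<Rightarrow> nat \<Rightarrow> nat \<Rightarrow> 'k :: field mat" where
  "eps m n r =
    (let a = (m - r) * n - 1; c = r * n;
         extend = (\<lambda>B. four_block_mat (1\<^sub>m a) (0\<^sub>m a (1 + c)) (0\<^sub>m (1 + c) a) B)
     in extend (four_block_mat (0\<^sub>m c 1) (1\<^sub>m c)
                               (1\<^sub>m 1) (0\<^sub>m 1 c)) *
        extend (four_block_mat (1\<^sub>m 1) (b_row n r)
                               (0\<^sub>m c 1) (1\<^sub>m c)))"

lemma eps_0:
  assumes "m \<ge> 1" "n \<ge> 1"
  shows "eps m n 0 = (1\<^sub>m (m * n) :: 'k :: field mat)"
proof -
  have mn: "m * n - 1 + 1 = m * n"
    using assms by simp
  have 1: "four_block_mat (0\<^sub>m 0 1) (1\<^sub>m 0) (1\<^sub>m 1) (0\<^sub>m 1 0) = (1\<^sub>m 1 :: 'k mat)"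
    by (rule eq_matI) auto
  have 2: "four_block_mat (1\<^sub>m 1) (b_row n 0) (0\<^sub>m 0 1) (1\<^sub>m 0) = (1\<^sub>m 1 :: 'k mat)"
    by (rule eq_matI) auto
  have 3: "four_block_mat (1\<^sub>m a) (0\<^sub>m a 1) (0\<^sub>m 1 a) (1\<^sub>m 1) = (1\<^sub>m (a + 1) :: 'k mat)" for a
    by (rule eq_matI) auto
  show ?thesis
    unfolding eps_def Let_def by (simp add: 1[simplified] 2[simplified] 3[simplified] mn[simplified])
qed

end

theory Submission
  imports Defs "Jordan_Normal_Form.Determinant"
begin

text \<open>
  A matrix in \<open>GL\<^sub>m\<^sub>n\<close> is determined modulo \<open>P\<close> on the left by its last row up to a nonzero scalar.
  Cutting this row into \<open>m\<close> pieces of length \<open>n\<close> gives an \<open>m \<times> n\<close> matrix \<open>M \<noteq> 0\<close>, and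
  \<open>t(h,g)\<close> acts on the right by sending \<open>M\<close> to \<open>h\<^sup>T M g\<close>. The double cosets therefore
  correspond to the possible ranks \<open>1, \<dots>, n\<close> of \<open>M\<close>, and \<open>\<epsilon>\<^sub>r\<close> gives rank \<open>r + 1\<close>.
\<close>

section \<open>General linear groups\<close>

text \<open>The scalar left free in the last row costs nothing: it is absorbed into
  \<open>h\<close>, so the classes are exact orbits of GL_m x GL_n, and invertibility removes only
  the zero orbit. Since m \<ge> n, the rank is at most n. Rank is not handled as a dimension here:
  an orbit is named by its normal form \<open>rank_mat m n k\<close>, reached by Gaussian
  elimination, and different normal forms are told apart by a determinant that would have to vanish.
  The shape of \<open>eps m n r\<close> is explained by its last row: zeros, then a 1 at position
  (m-r)n counted from 1, then \<open>b_row n r\<close>. That 1 closes row m-r of M, which is thus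
  e_n^T, and the blocks of \<open>b_row n r\<close> fill the r rows below with e_(n-1)^T, ...,
  e_(n-r)^T. The r+1 ones lie on an antidiagonal that starts at the right edge of M and ends in its
  bottom row; counted from 0 it is i + j + r + 2 = m + n.\<close>

lemma carrier_GL_iff: "A \<in> carrier (GL n) \<longleftrightarrow> A \<in> carrier_mat n n \<and> det A \<noteq> 0"
  for A :: "'k :: field mat"
proof
  assume "A \<in> carrier (GL n)"
  then have U: "A \<in> Units (ring_mat TYPE('k) n ())"
    by (simp add: GL_def units_of_def)
  then have "A \<in> carrier_mat n n"
    by (auto simp: Units_def ring_mat_simps)
  with unit_imp_det_non_zero[OF U] show "A \<in> carrier_mat n n \<and> det A \<noteq> 0" by simp
next
  assume "A \<in> carrier_mat n n \<and> det A \<noteq> 0"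
  then show "A \<in> carrier (GL n)"
    using det_non_zero_imp_unit[of A n "()"] by (simp add: GL_def units_of_def)
qed

lemma mult_GL [simp]: "A \<otimes>\<^bsub>GL n\<^esub> B = A * B"
  by (simp add: GL_def units_of_def ring_mat_simps)

lemma GL_carrier_mat: "A \<in> carrier (GL n) \<Longrightarrow> A \<in> carrier_mat n n"
  by (simp add: carrier_GL_iff)

lemma GL_one: "1\<^sub>m n \<in> carrier (GL n)"
  by (simp add: carrier_GL_iff)

lemma GL_mult: "A \<in> carrier (GL n) \<Longrightarrow> B \<in> carrier (GL n) \<Longrightarrow> A * B \<in> carrier (GL n)"
  by (auto simp: carrier_GL_iff det_mult[of _ n])

lemma GL_transpose: "A \<in> carrier (GL n) \<Longrightarrow> transpose_mat A \<in> carrier (GL n)"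
  by (auto simp: carrier_GL_iff det_transpose[of _ n])

lemma GL_smult: "A \<in> carrier (GL n) \<Longrightarrow> c \<noteq> 0 \<Longrightarrow> c \<cdot>\<^sub>m A \<in> carrier (GL n)"
  by (simp add: carrier_GL_iff)

text \<open>The determinants multiply to 1, so a one-sided inverse is enough. This gives
  invertibility of Kronecker products and of the cyclic permutation in \<open>eps\<close> without
  computing their determinants.\<close>

lemma GL_of_right_inverse:
  assumes "A \<in> carrier_mat n n" "B \<in> carrier_mat n n" "A * B = 1\<^sub>m n"
  shows "A \<in> carrier (GL n)" "B \<in> carrier (GL n)"
proof -
  have "det A * det B = 1"
    using det_mult[OF assms(1,2)] assms(3) by simp
  then show "A \<in> carrier (GL n)" "B \<in> carrier (GL n)"
    using assms by (auto simp: carrier_GL_iff)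
qed

lemma GL_inverse:
  assumes "A \<in> carrier (GL n)"
  obtains B where "B \<in> carrier (GL n)" "A * B = 1\<^sub>m n" "B * A = 1\<^sub>m n"
proof -
  from assms have "A \<in> Units (ring_mat TYPE('a) n ())"
    by (simp add: GL_def units_of_def)
  then obtain B where "B \<in> carrier_mat n n" "A * B = 1\<^sub>m n" "B * A = 1\<^sub>m n"
    by (auto simp: Units_def ring_mat_simps)
  with GL_of_right_inverse[of A n B] GL_carrier_mat[OF assms] that show thesis by blast
qed

lemma GL_block_diag:
  assumes "A \<in> carrier (GL p)" "B \<in> carrier (GL q)"
  shows "four_block_mat A (0\<^sub>m p q) (0\<^sub>m q p) B \<in> carrier (GL (p + q))"
  using assms det_four_block_mat_upper_right_zero[of A p "0\<^sub>m p q" q "0\<^sub>m q p" B]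
  by (simp add: carrier_GL_iff)

section \<open>Equivalence of rectangular matrices\<close>

text \<open>The orbit relation of GL_m x GL_n. A Kronecker product acts through the transpose of
  \<open>h\<close>; the relation can drop the transpose because GL_m is stable under it.\<close>

definition equivalent_mat :: "nat \<Rightarrow> nat \<Rightarrow> 'k :: field mat \<Rightarrow> 'k mat \<Rightarrow> bool" where
  "equivalent_mat m n A B \<longleftrightarrow> (\<exists>h \<in> carrier (GL m). \<exists>g \<in> carrier (GL n). B = h * A * g)"

lemma equivalent_mat_refl:
  assumes "A \<in> carrier_mat m n"
  shows "equivalent_mat m n A A"
  unfolding equivalent_mat_def
  by (rule bexI[OF _ GL_one], rule bexI[OF _ GL_one]) (use assms in simp)

lemma equivalent_mat_sym:
  assumes "A \<in> carrier_mat m n" "equivalent_mat m n A B"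
  shows "equivalent_mat m n B A"
proof -
  from assms(2) obtain h g where h: "h \<in> carrier (GL m)" and g: "g \<in> carrier (GL n)"
    and B: "B = h * A * g" by (auto simp: equivalent_mat_def)
  obtain h' where h': "h' \<in> carrier (GL m)" "h' * h = 1\<^sub>m m" using GL_inverse[OF h] by metis
  obtain g' where g': "g' \<in> carrier (GL n)" "g * g' = 1\<^sub>m n" using GL_inverse[OF g] by metis
  note c = GL_carrier_mat[OF h] GL_carrier_mat[OF g] GL_carrier_mat[OF h'(1)]
    GL_carrier_mat[OF g'(1)] assms(1)
  have "h' * B * g' = (h' * h) * A * (g * g')"
    using c unfolding B by (simp add: assoc_mult_mat[of _ m m _ m _ n] assoc_mult_mat[of _ m n _ n _ n]
       assoc_mult_mat[of _ m m _ n _ n])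
  then have "A = h' * B * g'" using h'(2) g'(2) assms(1) by simp
  then show ?thesis using h'(1) g'(1) by (auto simp: equivalent_mat_def)
qed

lemma equivalent_mat_trans:
  assumes "A \<in> carrier_mat m n" "equivalent_mat m n A B" "equivalent_mat m n B C"
  shows "equivalent_mat m n A C"
proof -
  from assms(2) obtain h g where h: "h \<in> carrier (GL m)" and g: "g \<in> carrier (GL n)"
    and B: "B = h * A * g" by (auto simp: equivalent_mat_def)
  from assms(3) obtain h' g' where h': "h' \<in> carrier (GL m)" and g': "g' \<in> carrier (GL n)"
    and C: "C = h' * B * g'" by (auto simp: equivalent_mat_def)
  note c = GL_carrier_mat[OF h] GL_carrier_mat[OF g] GL_carrier_mat[OF h']
    GL_carrier_mat[OF g'] assms(1)
  have "C = (h' * h) * A * (g * g')"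
    using c unfolding B C by (simp add: assoc_mult_mat[of _ m m _ m _ n] assoc_mult_mat[of _ m n _ n _ n]
       assoc_mult_mat[of _ m m _ n _ n])
  then show ?thesis using GL_mult[OF h' h] GL_mult[OF g g'] by (auto simp: equivalent_mat_def)
qed

text \<open>Left multiplication by the identity with permuted rows; its determinant is the sign of
  \<open>p\<close>, hence nonzero.\<close>

lemma equivalent_mat_permute_rows:
  fixes A :: "'k :: field mat"
  assumes A: "A \<in> carrier_mat m n" and p: "p permutes {0..<m}"
  shows "equivalent_mat m n A (mat m n (\<lambda>(i, j). A $$ (p i, j)))"
proof -
  define S :: "'k mat" where "S = mat m m (\<lambda>(i, j). 1\<^sub>m m $$ (p i, j))"
  have S: "S \<in> carrier (GL m)"
    using det_permute_rows[OF one_carrier_mat p, where ?'a = 'k]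
    by (simp add: S_def carrier_GL_iff sign_def)
  have "mat m n (\<lambda>(i, j). A $$ (p i, j)) = S * A"
  proof (rule eq_matI)
    fix i j assume "i < dim_row (S * A)" "j < dim_col (S * A)"
    then have i: "i < m" and j: "j < n" using A by (auto simp: S_def)
    have pi: "p i < m" using permutes_in_image[OF p, of i] i by simp
    have "row S i = unit_vec m (p i)"
      using i pi by (auto simp: S_def)
    then show "mat m n (\<lambda>(i, j). A $$ (p i, j)) $$ (i, j) = (S * A) $$ (i, j)"
      using i j pi A by (simp add: S_def)
  qed (use A in \<open>auto simp: S_def\<close>)
  moreover have "S * A = S * A * 1\<^sub>m n" using A by (simp add: S_def)
  ultimately show ?thesis
    unfolding equivalent_mat_def using S GL_one by metis
qed

lemma equivalent_mat_transpose:
  assumes A: "A \<in> carrier_mat m n" and "equivalent_mat m n A B"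
  shows "equivalent_mat n m (transpose_mat A) (transpose_mat B)"
proof -
  from assms(2) obtain h g where h: "h \<in> carrier (GL m)" and g: "g \<in> carrier (GL n)"
    and B: "B = h * A * g" by (auto simp: equivalent_mat_def)
  note c = GL_carrier_mat[OF h] GL_carrier_mat[OF g] A
  have "transpose_mat B = transpose_mat g * (transpose_mat A * transpose_mat h)"
    using c unfolding B by (simp add: transpose_mult[of _ m n _ n] transpose_mult[of _ m m _ n])
  also have "\<dots> = transpose_mat g * transpose_mat A * transpose_mat h"
    using c by (simp add: assoc_mult_mat[of _ n n _ m _ m])
  finally show ?thesis
    using GL_transpose[OF h] GL_transpose[OF g] by (auto simp: equivalent_mat_def)
qed

lemma equivalent_mat_permute_cols:
  fixes A :: "'k :: field mat"
  assumes A: "A \<in> carrier_mat m n" and p: "p permutes {0..<n}"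
  shows "equivalent_mat m n A (mat m n (\<lambda>(i, j). A $$ (i, p j)))"
proof -
  have "equivalent_mat m n (transpose_mat (transpose_mat A))
      (transpose_mat (mat n m (\<lambda>(i, j). transpose_mat A $$ (p i, j))))"
    using A by (intro equivalent_mat_transpose equivalent_mat_permute_rows[OF _ p]) simp_all
  also have "transpose_mat (mat n m (\<lambda>(i, j). transpose_mat A $$ (p i, j))) =
      mat m n (\<lambda>(i, j). A $$ (i, p j))"
  proof (rule eq_matI)
    fix i j assume "i < dim_row (mat m n (\<lambda>(i, j). A $$ (i, p j)))"
      "j < dim_col (mat m n (\<lambda>(i, j). A $$ (i, p j)))"
    then show "transpose_mat (mat n m (\<lambda>(i, j). transpose_mat A $$ (p i, j))) $$ (i, j) =
        mat m n (\<lambda>(i, j). A $$ (i, p j)) $$ (i, j)"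
      using permutes_in_image[OF p, of j] A by simp
  qed simp_all
  finally show ?thesis by simp
qed

lemma equivalent_mat_permute:
  fixes A :: "'k :: field mat"
  assumes A: "A \<in> carrier_mat m n" and p: "p permutes {0..<m}" and q: "q permutes {0..<n}"
  shows "equivalent_mat m n A (mat m n (\<lambda>(i, j). A $$ (p i, q j)))"
proof -
  let ?B = "mat m n (\<lambda>(i, j). A $$ (p i, j))"
  have "mat m n (\<lambda>(i, j). ?B $$ (i, q j)) = mat m n (\<lambda>(i, j). A $$ (p i, q j))"
    using permutes_in_image[OF q] by (intro eq_matI) auto
  then show ?thesis
    using equivalent_mat_trans[OF A equivalent_mat_permute_rows[OF A p]
        equivalent_mat_permute_cols[OF _ q]] by simp
qed

section \<open>Reduction to a normal form\<close>

text \<open>For \<open>k\<close> beyond \<open>min m n\<close> the matrix no longer changes, which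
  is why uniqueness is stated with bounds on the index.\<close>

definition rank_mat :: "nat \<Rightarrow> nat \<Rightarrow> nat \<Rightarrow> 'k :: field mat" where
  "rank_mat m n k = mat m n (\<lambda>(i, j). if i = j \<and> i < k then 1 else 0)"

lemma rank_mat_carrier [simp]: "rank_mat m n k \<in> carrier_mat m n"
  by (simp add: rank_mat_def)

lemma rank_mat_0: "rank_mat m n 0 = 0\<^sub>m m n"
  by (rule eq_matI) (simp_all add: rank_mat_def)

lemma rank_mat_Suc:
  "four_block_mat (1\<^sub>m 1) (0\<^sub>m 1 n) (0\<^sub>m m 1) (rank_mat m n k) = rank_mat (Suc m) (Suc n) (Suc k)"
  by (rule eq_matI) (auto simp: rank_mat_def)

text \<open>Bordering \<open>h\<close> and \<open>g\<close> by a 1 as well carries an equivalence of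
  the remaining block over to the matrix with a split-off pivot, as the induction on the number of
  rows requires.\<close>

lemma equivalent_mat_block:
  fixes A :: "'k :: field mat"
  assumes A: "A \<in> carrier_mat m n" and "equivalent_mat m n A B"
  shows "equivalent_mat (Suc m) (Suc n) (four_block_mat (1\<^sub>m 1) (0\<^sub>m 1 n) (0\<^sub>m m 1) A)
    (four_block_mat (1\<^sub>m 1) (0\<^sub>m 1 n) (0\<^sub>m m 1) B)"
proof -
  from assms(2) obtain h g where h: "h \<in> carrier (GL m)" and g: "g \<in> carrier (GL n)"
    and B: "B = h * A * g" by (auto simp: equivalent_mat_def)
  note c = GL_carrier_mat[OF h] GL_carrier_mat[OF g] A
  let ?h = "four_block_mat (1\<^sub>m 1) (0\<^sub>m 1 m) (0\<^sub>m m 1) h"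
  let ?g = "four_block_mat (1\<^sub>m 1) (0\<^sub>m 1 n) (0\<^sub>m n 1) g"
  let ?A = "four_block_mat (1\<^sub>m 1) (0\<^sub>m 1 n) (0\<^sub>m m 1) A"
  let ?C = "four_block_mat (1\<^sub>m 1) (0\<^sub>m 1 n) (0\<^sub>m m 1) (h * A)"
  have "?h * ?A = ?C"
    using c by (subst mult_four_block_mat[of _ 1 1 _ m _ m _ _ 1 _ n]) auto
  moreover have "?C * ?g = four_block_mat (1\<^sub>m 1) (0\<^sub>m 1 n) (0\<^sub>m m 1) B"
    using c by (subst mult_four_block_mat[of _ 1 1 _ n _ m _ _ 1 _ n]) (auto simp: B)
  ultimately show ?thesis
    using GL_block_diag[OF GL_one h] GL_block_diag[OF GL_one g]
    unfolding equivalent_mat_def by (metis plus_1_eq_Suc)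
qed

text \<open>One step of Gaussian elimination in block form. \<open>?h\<close> scales the pivot row
  to 1 and clears the column below it, \<open>?g\<close> clears the rest of the row, and the block
  left over is the Schur complement Z - a^(-1) Y X.\<close>

lemma equivalent_mat_clear_pivot:
  fixes a :: "'k :: field"
  assumes a: "a \<noteq> 0" and X: "X \<in> carrier_mat 1 n" and Y: "Y \<in> carrier_mat m 1"
    and Z: "Z \<in> carrier_mat m n"
  shows "\<exists>A \<in> carrier_mat m n. equivalent_mat (Suc m) (Suc n)
    (four_block_mat (a \<cdot>\<^sub>m 1\<^sub>m 1) X Y Z) (four_block_mat (1\<^sub>m 1) (0\<^sub>m 1 n) (0\<^sub>m m 1) A)"
proof -
  let ?b = "inverse a"
  let ?h = "four_block_mat (?b \<cdot>\<^sub>m 1\<^sub>m 1) (0\<^sub>m 1 m) (- ?b \<cdot>\<^sub>m Y) (1\<^sub>m m)"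
  let ?g = "four_block_mat (1\<^sub>m 1) (- ?b \<cdot>\<^sub>m X) (0\<^sub>m n 1) (1\<^sub>m n)"
  let ?M = "four_block_mat (a \<cdot>\<^sub>m 1\<^sub>m 1) X Y Z"
  let ?A = "Z + - ?b \<cdot>\<^sub>m (Y * X)"
  let ?N = "four_block_mat (1\<^sub>m 1) (?b \<cdot>\<^sub>m X) (0\<^sub>m m 1) ?A"
  have h: "?h \<in> carrier (GL (Suc m))"
    using det_four_block_mat_upper_right_zero[of "?b \<cdot>\<^sub>m 1\<^sub>m 1" 1 "0\<^sub>m 1 m" m "- ?b \<cdot>\<^sub>m Y" "1\<^sub>m m"]
      four_block_carrier_mat[of "?b \<cdot>\<^sub>m 1\<^sub>m 1" 1 1 "1\<^sub>m m" m m] a Y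
    by (simp add: carrier_GL_iff)
  have g: "?g \<in> carrier (GL (Suc n))"
    using det_four_block_mat_lower_left_zero[of "1\<^sub>m 1" 1 "- ?b \<cdot>\<^sub>m X" n "0\<^sub>m n 1" "1\<^sub>m n"]
      four_block_carrier_mat[of "1\<^sub>m 1 :: 'k mat" 1 1 "1\<^sub>m n" n n] X
    by (simp add: carrier_GL_iff)
  have "?h * ?M = ?N"
  proof (subst mult_four_block_mat[of _ 1 1 _ m _ m _ _ 1 _ n])
    have e1: "?b \<cdot>\<^sub>m 1\<^sub>m 1 * (a \<cdot>\<^sub>m 1\<^sub>m 1) + 0\<^sub>m 1 m * Y = 1\<^sub>m 1"
      using Y a by (intro eq_matI) (simp_all add: scalar_prod_def)
    have e2: "?b \<cdot>\<^sub>m 1\<^sub>m 1 * X + 0\<^sub>m 1 m * Z = ?b \<cdot>\<^sub>m X"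
      using X Z by (simp add: mult_smult_assoc_mat[of _ 1 1 _ n])
    have e3: "- ?b \<cdot>\<^sub>m Y * (a \<cdot>\<^sub>m 1\<^sub>m 1) + 1\<^sub>m m * Y = 0\<^sub>m m 1"
      using Y a by (intro eq_matI) (simp_all add: scalar_prod_def)
    have e4: "- ?b \<cdot>\<^sub>m Y * X + 1\<^sub>m m * Z = ?A"
      using X Y Z by (simp add: mult_smult_assoc_mat[of _ m 1 _ n] comm_add_mat[of _ m n])
    show "four_block_mat (?b \<cdot>\<^sub>m 1\<^sub>m 1 * (a \<cdot>\<^sub>m 1\<^sub>m 1) + 0\<^sub>m 1 m * Y) (?b \<cdot>\<^sub>m 1\<^sub>m 1 * X + 0\<^sub>m 1 m * Z)
      (- ?b \<cdot>\<^sub>m Y * (a \<cdot>\<^sub>m 1\<^sub>m 1) + 1\<^sub>m m * Y) (- ?b \<cdot>\<^sub>m Y * X + 1\<^sub>m m * Z) = ?N"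
      unfolding e1 e2 e3 e4 ..
  qed (use X Y Z in simp_all)
  moreover have "?N * ?g = four_block_mat (1\<^sub>m 1) (0\<^sub>m 1 n) (0\<^sub>m m 1) ?A"
  proof (subst mult_four_block_mat[of _ 1 1 _ n _ m _ _ 1 _ n])
    have e1: "1\<^sub>m 1 * 1\<^sub>m 1 + ?b \<cdot>\<^sub>m X * 0\<^sub>m n 1 = 1\<^sub>m 1"
      using X by simp
    have e2: "1\<^sub>m 1 * (- ?b \<cdot>\<^sub>m X) + ?b \<cdot>\<^sub>m X * 1\<^sub>m n = 0\<^sub>m 1 n"
      using X by (intro eq_matI) simp_all
    have e3: "0\<^sub>m m 1 * 1\<^sub>m 1 + ?A * 0\<^sub>m n 1 = 0\<^sub>m m 1"
      using X Y Z by simp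
    have e4: "0\<^sub>m m 1 * (- ?b \<cdot>\<^sub>m X) + ?A * 1\<^sub>m n = ?A"
      using X Y Z by simp
    show "four_block_mat (1\<^sub>m 1 * 1\<^sub>m 1 + ?b \<cdot>\<^sub>m X * 0\<^sub>m n 1) (1\<^sub>m 1 * (- ?b \<cdot>\<^sub>m X) + ?b \<cdot>\<^sub>m X * 1\<^sub>m n)
      (0\<^sub>m m 1 * 1\<^sub>m 1 + ?A * 0\<^sub>m n 1) (0\<^sub>m m 1 * (- ?b \<cdot>\<^sub>m X) + ?A * 1\<^sub>m n) =
      four_block_mat (1\<^sub>m 1) (0\<^sub>m 1 n) (0\<^sub>m m 1) ?A"
      unfolding e1 e2 e3 e4 ..
  qed (use X Y Z in simp_all)
  ultimately have "equivalent_mat (Suc m) (Suc n) ?M (four_block_mat (1\<^sub>m 1) (0\<^sub>m 1 n) (0\<^sub>m m 1) ?A)"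
    using h g unfolding equivalent_mat_def by metis
  moreover have "?A \<in> carrier_mat m n" using X Y Z by simp
  ultimately show ?thesis by blast
qed

lemma equivalent_rank_mat:
  fixes A :: "'k :: field mat"
  assumes "A \<in> carrier_mat m n"
  shows "\<exists>k \<le> min m n. equivalent_mat m n A (rank_mat m n k)"
  using assms
proof (induction m arbitrary: n A)
  case 0
  then have "A = rank_mat 0 n 0" by (intro eq_matI) (auto simp: rank_mat_def)
  then show ?case using equivalent_mat_refl[OF 0] by auto
next
  case (Suc m)
  note A = Suc.prems
  show ?case
  proof (cases "A = 0\<^sub>m (Suc m) n")
    case True
    then show ?thesis using equivalent_mat_refl[OF A] by (auto simp: rank_mat_0 intro!: exI[of _ 0])
  next
    case False
    then obtain i j where i: "i < Suc m" and j: "j < n" and nz: "A $$ (i, j) \<noteq> 0"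
      using A by (metis eq_matI carrier_matD index_zero_mat)
    then obtain n' where n: "n = Suc n'" by (cases n) auto
    \<comment> \<open>These swaps bring the nonzero entry into the corner, where it serves as
      pivot.\<close>
    let ?p = "Transposition.transpose 0 i" and ?q = "Transposition.transpose 0 j"
    have p: "?p permutes {0..<Suc m}" using i by (intro permutes_swap_id) auto
    have q: "?q permutes {0..<n}" using j by (intro permutes_swap_id) auto
    define B where "B = mat (Suc m) n (\<lambda>(i, j). A $$ (?p i, ?q j))"
    have AB: "equivalent_mat (Suc m) n A B"
      unfolding B_def by (rule equivalent_mat_permute[OF A p q])
    obtain X0 X Y Z where split: "split_block B 1 1 = (X0, X, Y, Z)" by (metis prod_cases4)
    have "dim_row B = 1 + m" "dim_col B = 1 + n'" by (simp_all add: B_def n)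
    from split_block[OF split this]
    have B: "B = four_block_mat X0 X Y Z" and c: "X0 \<in> carrier_mat 1 1" "X \<in> carrier_mat 1 n'"
      "Y \<in> carrier_mat m 1" "Z \<in> carrier_mat m n'" by auto
    have X0: "X0 = A $$ (i, j) \<cdot>\<^sub>m 1\<^sub>m 1"
      using split by (intro eq_matI) (auto simp: split_block_def Let_def B_def n)
    from equivalent_mat_clear_pivot[OF nz c(2,3,4)] obtain C where C: "C \<in> carrier_mat m n'"
      and BC: "equivalent_mat (Suc m) n B (four_block_mat (1\<^sub>m 1) (0\<^sub>m 1 n') (0\<^sub>m m 1) C)"
      unfolding B X0 n by blast
    from Suc.IH[OF C] obtain k where k: "k \<le> min m n'"
      and Ck: "equivalent_mat m n' C (rank_mat m n' k)" by blast
    have "equivalent_mat (Suc m) n (four_block_mat (1\<^sub>m 1) (0\<^sub>m 1 n') (0\<^sub>m m 1) C)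
        (rank_mat (Suc m) n (Suc k))"
      using equivalent_mat_block[OF C Ck] by (simp only: rank_mat_Suc n)
    moreover have "B \<in> carrier_mat (Suc m) n" by (simp add: B_def)
    ultimately have "equivalent_mat (Suc m) n A (rank_mat (Suc m) n (Suc k))"
      using equivalent_mat_trans A AB BC by blast
    moreover have "Suc k \<le> min (Suc m) n" using k n by simp
    ultimately show ?thesis by blast
  qed
qed

section \<open>Uniqueness of the normal form\<close>

text \<open>The easy half of the Frobenius-Koenig theorem: every Leibniz term vanishes, because a
  permutation cannot send \<open>l\<close> rows into only \<open>k\<close> < \<open>l\<close>
  columns and so meets the zero block.\<close>

lemma det_zero_block:
  fixes A :: "'k :: field mat"
  assumes A: "A \<in> carrier_mat n n" and "l \<le> n" "k < l"
    and zero: "\<And>i j. i < l \<Longrightarrow> k \<le> j \<Longrightarrow> j < n \<Longrightarrow> A $$ (i, j) = 0"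
  shows "det A = 0"
proof -
  have "(\<Prod>i = 0..<n. A $$ (i, p i)) = 0" if p: "p permutes {0..<n}" for p
  proof -
    have "\<exists>i < l. k \<le> p i"
    proof (rule ccontr)
      assume "\<not> (\<exists>i < l. k \<le> p i)"
      then have "p ` {..<l} \<subseteq> {..<k}" by auto
      then have "card (p ` {..<l}) \<le> k" using card_mono[of "{..<k}"] by fastforce
      moreover have "card (p ` {..<l}) = l"
        using permutes_inj[OF p] by (simp add: card_image inj_on_subset)
      ultimately show False using \<open>k < l\<close> by simp
    qed
    then obtain i where i: "i < l" "k \<le> p i" by blast
    then have "i \<in> {0..<n}" using \<open>l \<le> n\<close> by simp
    moreover have "p i < n" using permutes_in_image[OF p] \<open>i \<in> {0..<n}\<close> by auto
    ultimately have "A $$ (i, p i) = 0" using zero i by blast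
    then show ?thesis using \<open>i \<in> {0..<n}\<close> by (intro prod_zero) auto
  qed
  then show ?thesis unfolding det_def'[OF A] by (intro sum.neutral) simp
qed

text \<open>Rewrite the equivalence as L g' = h K with g' inverse to g. On the left the first
  \<open>l\<close> rows are those of g'; on the right all columns from \<open>k\<close> on are zero.
  If \<open>k\<close> < \<open>l\<close>, the invertible g' would contain the zero block excluded by
  \<open>det_zero_block\<close>.\<close>

lemma equivalent_rank_mat_le:
  assumes "equivalent_mat m n (rank_mat m n k :: 'k :: field mat) (rank_mat m n l)"
    and l: "l \<le> min m n"
  shows "l \<le> k"
proof (rule ccontr)
  assume "\<not> l \<le> k"
  let ?K = "rank_mat m n k :: 'k mat" and ?L = "rank_mat m n l :: 'k mat"
  from assms obtain h g where h: "h \<in> carrier (GL m)" and g: "g \<in> carrier (GL n)"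
    and eq: "?L = h * ?K * g" by (auto simp: equivalent_mat_def)
  obtain g' where g': "g' \<in> carrier (GL n)" "g * g' = 1\<^sub>m n" using GL_inverse[OF g] by metis
  note c = GL_carrier_mat[OF h] GL_carrier_mat[OF g] GL_carrier_mat[OF g'(1)]
  have "?L * g' = h * ?K * (g * g')"
    unfolding eq using c by (simp add: assoc_mult_mat[of "h * ?K" m n _ n _ n])
  moreover have "h * ?K \<in> carrier_mat m n" using c by simp
  ultimately have Lg: "?L * g' = h * ?K" using g'(2) right_mult_one_mat by metis
  have "det g' = 0"
  proof (rule det_zero_block[OF c(3)])
    show "l \<le> n" using l by simp
    show "k < l" using \<open>\<not> l \<le> k\<close> by simp
    fix i j assume ij: "i < l" "k \<le> j" "j < n"
    then have im: "i < m" "i < n" using l by auto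
    have "row ?L i = unit_vec n i"
      using im ij by (auto simp: rank_mat_def)
    then have "g' $$ (i, j) = (?L * g') $$ (i, j)"
      using im ij c by (simp add: rank_mat_def)
    also have "\<dots> = row h i \<bullet> col ?K j"
      unfolding Lg using im ij c by (simp add: rank_mat_def)
    also have "col ?K j = 0\<^sub>v m"
      using ij by (auto simp: rank_mat_def)
    finally show "g' $$ (i, j) = 0"
      using im c by simp
  qed
  with g' show False by (simp add: carrier_GL_iff)
qed

lemma equivalent_rank_mat_unique:
  fixes A :: "'k :: field mat"
  assumes A: "A \<in> carrier_mat m n" and "k \<le> min m n" "l \<le> min m n"
    and k: "equivalent_mat m n A (rank_mat m n k)" and l: "equivalent_mat m n A (rank_mat m n l)"
  shows "k = l"
proof -
  have "equivalent_mat m n (rank_mat m n k :: 'k mat) (rank_mat m n l)"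
    using equivalent_mat_trans[OF _ equivalent_mat_sym[OF A k] l] by simp
  moreover have "equivalent_mat m n (rank_mat m n l :: 'k mat) (rank_mat m n k)"
    using equivalent_mat_trans[OF _ equivalent_mat_sym[OF A l] k] by simp
  ultimately show ?thesis using equivalent_rank_mat_le assms(2,3) by (meson le_antisym)
qed

section \<open>Kronecker products\<close>

text \<open>Row-major order is forced by \<open>kronecker\<close>, where \<open>div\<close> selects
  the block and \<open>mod\<close> the place inside it.\<close>

definition unflatten :: "nat \<Rightarrow> nat \<Rightarrow> 'a vec \<Rightarrow> 'a mat" where
  "unflatten m n v = mat m n (\<lambda>(i, j). v $ (i * n + j))"

lemma mult_add_less_mult:
  fixes i j m n :: nat
  assumes "i < m" "j < n"
  shows "i * n + j < m * n"
proof -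
  have "i * n + j < Suc i * n" using assms by simp
  also have "\<dots> \<le> m * n" using assms by (intro mult_le_mono1) simp
  finally show ?thesis .
qed

lemma unflatten_carrier [simp]: "unflatten m n v \<in> carrier_mat m n"
  by (simp add: unflatten_def)

lemma sum_mult_add:
  fixes f :: "nat \<Rightarrow> 'a :: comm_monoid_add"
  shows "sum f {0..<m * n} = (\<Sum>p = 0..<m. \<Sum>q = 0..<n. f (p * n + q))"
proof -
  have "sum f {0..<m * n} = (\<Sum>p<m. sum f {p * n..<p * n + n})"
    by (simp add: sum.nat_group atLeast0LessThan)
  also have "\<dots> = (\<Sum>p<m. \<Sum>q = 0..<n. f (p * n + q))"
  proof (rule sum.cong[OF refl])
    fix p show "sum f {p * n..<p * n + n} = (\<Sum>q = 0..<n. f (p * n + q))"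
      using sum.shift_bounds_nat_ivl[of f 0 "p * n" n] by (simp add: add.commute)
  qed
  finally show ?thesis by (simp add: atLeast0LessThan)
qed

lemma index_mult_mat_sum:
  assumes "A \<in> carrier_mat r n" "B \<in> carrier_mat n c" "i < r" "j < c"
  shows "(A * B) $$ (i, j) = (\<Sum>s = 0..<n. A $$ (i, s) * B $$ (s, j))"
  using assms by (simp add: scalar_prod_def)

lemma kronecker_carrier:
  assumes "h \<in> carrier_mat m m'" "g \<in> carrier_mat n n'"
  shows "kronecker h g \<in> carrier_mat (m * n) (m' * n')"
  using assms by (simp add: kronecker_def)

lemma kronecker_index:
  assumes "h \<in> carrier_mat m m'" "g \<in> carrier_mat n n'" "p < m" "q < n" "i < m'" "j < n'"
  shows "kronecker h g $$ (p * n + q, i * n' + j) = h $$ (p, i) * g $$ (q, j)"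
  using assms by (simp add: kronecker_def mult_add_less_mult)

text \<open>Splitting the summation index as p * n + q decouples the two factors. Both the
  mixed-product rule and the action on last rows are read off from this double sum.\<close>

lemma mult_kronecker_index:
  fixes A :: "'k :: field mat"
  assumes A: "A \<in> carrier_mat r (m * n)" and h: "h \<in> carrier_mat m m'"
    and g: "g \<in> carrier_mat n n'" and "l < r" "i < m'" "j < n'"
  shows "(A * kronecker h g) $$ (l, i * n' + j) =
    (\<Sum>p = 0..<m. \<Sum>q = 0..<n. A $$ (l, p * n + q) * (h $$ (p, i) * g $$ (q, j)))"
proof -
  note K = kronecker_carrier[OF h g]
  have ij: "i * n' + j < m' * n'" using assms by (simp add: mult_add_less_mult)
  have "(A * kronecker h g) $$ (l, i * n' + j) =
    (\<Sum>s = 0..<m * n. A $$ (l, s) * kronecker h g $$ (s, i * n' + j))"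
    using A K ij \<open>l < r\<close> by (simp add: scalar_prod_def)
  also have "\<dots> = (\<Sum>p = 0..<m. \<Sum>q = 0..<n. A $$ (l, p * n + q) * (h $$ (p, i) * g $$ (q, j)))"
    unfolding sum_mult_add using assms by (intro sum.cong refl) (simp add: kronecker_index[OF h g])
  finally show ?thesis .
qed

lemma eq_matI_blocks:
  assumes "A \<in> carrier_mat r (m * n)" "B \<in> carrier_mat r (m * n)"
    and eq: "\<And>l i j. l < r \<Longrightarrow> i < m \<Longrightarrow> j < n \<Longrightarrow> A $$ (l, i * n + j) = B $$ (l, i * n + j)"
  shows "A = B"
proof (rule eq_matI)
  fix l s assume "l < dim_row B" "s < dim_col B"
  then have l: "l < r" and s: "s < m * n" using assms by auto
  have "n > 0" using s by (cases n) auto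
  then have "s div n < m" "s mod n < n" using s by (simp_all add: less_mult_imp_div_less)
  from eq[OF l this] show "A $$ (l, s) = B $$ (l, s)" by simp
qed (use assms in auto)

text \<open>The mixed-product rule: in block coordinates the double sum is a product of one sum over
  the \<open>h\<close> indices and one over the \<open>g\<close> indices.\<close>

lemma kronecker_mult:
  fixes h h' :: "'k :: field mat"
  assumes h: "h \<in> carrier_mat m m'" and g: "g \<in> carrier_mat n n'"
    and h': "h' \<in> carrier_mat m' m''" and g': "g' \<in> carrier_mat n' n''"
  shows "kronecker h g * kronecker h' g' = kronecker (h * h') (g * g')"
proof (rule eq_matI_blocks[where r = "m * n" and m = m'' and n = n''])
  note K = kronecker_carrier[OF h g] kronecker_carrier[OF h' g']
  have hh: "h * h' \<in> carrier_mat m m''" and gg: "g * g' \<in> carrier_mat n n''"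
    using assms by auto
  show "kronecker h g * kronecker h' g' \<in> carrier_mat (m * n) (m'' * n'')" using K by simp
  show "kronecker (h * h') (g * g') \<in> carrier_mat (m * n) (m'' * n'')"
    by (rule kronecker_carrier[OF hh gg])
  fix l i j assume l: "l < m * n" and i: "i < m''" and j: "j < n''"
  define a b where "a = l div n" and "b = l mod n"
  have "n > 0" using l by (cases n) auto
  then have a: "a < m" and b: "b < n" and lab: "l = a * n + b"
    using l by (simp_all add: a_def b_def less_mult_imp_div_less)
  have "(kronecker h g * kronecker h' g') $$ (l, i * n'' + j) =
    (\<Sum>p = 0..<m'. \<Sum>q = 0..<n'. kronecker h g $$ (l, p * n' + q) * (h' $$ (p, i) * g' $$ (q, j)))"
    by (rule mult_kronecker_index[OF K(1) h' g' l i j])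
  also have "\<dots> = (\<Sum>p = 0..<m'. \<Sum>q = 0..<n'. (h $$ (a, p) * h' $$ (p, i)) * (g $$ (b, q) * g' $$ (q, j)))"
    unfolding lab using a b by (intro sum.cong refl) (simp add: kronecker_index[OF h g])
  also have "\<dots> = (h * h') $$ (a, i) * (g * g') $$ (b, j)"
    using assms a b i j by (simp add: scalar_prod_def sum_product)
  also have "\<dots> = kronecker (h * h') (g * g') $$ (l, i * n'' + j)"
    unfolding lab using a b i j by (simp add: kronecker_index[OF hh gg])
  finally show "(kronecker h g * kronecker h' g') $$ (l, i * n'' + j) =
    kronecker (h * h') (g * g') $$ (l, i * n'' + j)" .
qed

lemma kronecker_one: "kronecker (1\<^sub>m m) (1\<^sub>m n) = 1\<^sub>m (m * n)"
proof (rule eq_matI)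
  fix i j assume "i < dim_row (1\<^sub>m (m * n))" "j < dim_col (1\<^sub>m (m * n))"
  then have ij: "i < m * n" "j < m * n" by auto
  then have "n > 0" by (cases n) auto
  moreover have "i = j \<longleftrightarrow> i div n = j div n \<and> i mod n = j mod n"
    by (metis div_mult_mod_eq)
  ultimately show "kronecker (1\<^sub>m m) (1\<^sub>m n) $$ (i, j) = 1\<^sub>m (m * n) $$ (i, j)"
    using ij by (auto simp: kronecker_def less_mult_imp_div_less)
qed (simp_all add: kronecker_def)

lemma kronecker_GL:
  fixes h g :: "'k :: field mat"
  assumes h: "h \<in> carrier (GL m)" and g: "g \<in> carrier (GL n)"
  shows "kronecker h g \<in> carrier (GL (m * n))"
proof -
  obtain h' where h': "h' \<in> carrier (GL m)" "h * h' = 1\<^sub>m m" using GL_inverse[OF h] by metis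
  obtain g' where g': "g' \<in> carrier (GL n)" "g * g' = 1\<^sub>m n" using GL_inverse[OF g] by metis
  note c = GL_carrier_mat[OF h] GL_carrier_mat[OF g] GL_carrier_mat[OF h'(1)]
    GL_carrier_mat[OF g'(1)]
  have "kronecker h g * kronecker h' g' = 1\<^sub>m (m * n)"
    using kronecker_mult[OF c] h'(2) g'(2) kronecker_one by metis
  then show ?thesis
    using GL_of_right_inverse(1) kronecker_carrier[OF c(1,2)] kronecker_carrier[OF c(3,4)] by blast
qed

text \<open>The identity vec(M) (h \<otimes> g) = vec(h^T M g) for row-major vec. The transpose
  appears because the block index of the row is summed against the row index of
  \<open>h\<close>.\<close>

lemma unflatten_row_mult_kronecker:
  fixes A :: "'k :: field mat"
  assumes A: "A \<in> carrier_mat r (m * n)" and h: "h \<in> carrier_mat m m" and g: "g \<in> carrier_mat n n"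
    and l: "l < r"
  shows "unflatten m n (row (A * kronecker h g) l) = transpose_mat h * unflatten m n (row A l) * g"
proof (rule eq_matI)
  let ?M = "unflatten m n (row A l)"
  note K = kronecker_carrier[OF h g]
  fix i j assume "i < dim_row (transpose_mat h * ?M * g)" "j < dim_col (transpose_mat h * ?M * g)"
  then have i: "i < m" and j: "j < n" using h g by auto
  have ij: "i * n + j < m * n" using i j by (simp add: mult_add_less_mult)
  have M: "?M $$ (p, q) = A $$ (l, p * n + q)" if "p < m" "q < n" for p q
    using that A l by (simp add: unflatten_def mult_add_less_mult)
  have "unflatten m n (row (A * kronecker h g) l) $$ (i, j) = (A * kronecker h g) $$ (l, i * n + j)"
    using i j ij A K l by (simp add: unflatten_def)
  also have "\<dots> = (\<Sum>p = 0..<m. \<Sum>q = 0..<n. A $$ (l, p * n + q) * (h $$ (p, i) * g $$ (q, j)))"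
    by (rule mult_kronecker_index[OF A h g l i j])
  also have "\<dots> = (\<Sum>p = 0..<m. \<Sum>q = 0..<n. h $$ (p, i) * ?M $$ (p, q) * g $$ (q, j))"
    by (intro sum.cong refl) (simp add: M)
  \<comment> \<open>With the order exchanged, the inner sum over \<open>p\<close> is an entry of h^T
    M.\<close>
  also have "\<dots> = (\<Sum>q = 0..<n. (\<Sum>p = 0..<m. h $$ (p, i) * ?M $$ (p, q)) * g $$ (q, j))"
    by (subst sum.swap) (simp add: sum_distrib_right)
  also have "\<dots> = (\<Sum>q = 0..<n. (transpose_mat h * ?M) $$ (i, q) * g $$ (q, j))"
    using h i by (intro sum.cong refl) (simp add: scalar_prod_def unflatten_def)
  also have "\<dots> = (transpose_mat h * ?M * g) $$ (i, j)"
    by (rule index_mult_mat_sum[symmetric, of _ m n _ n]) (use h g i j in auto)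
  finally show "unflatten m n (row (A * kronecker h g) l) $$ (i, j) = (transpose_mat h * ?M * g) $$ (i, j)" .
qed (use h g in \<open>auto simp: unflatten_def\<close>)

section \<open>Double cosets and last rows\<close>

text \<open>Serves twice: for elements of the parabolic, which rescale the last row, and for the
  permutation factor of \<open>eps\<close>, which moves a row to the bottom.\<close>

lemma row_unit_mult:
  fixes A :: "'k :: field mat"
  assumes A: "A \<in> carrier_mat r n" and B: "B \<in> carrier_mat n c" and "i < r" "j < n"
    and row: "row A i = d \<cdot>\<^sub>v unit_vec n j"
  shows "row (A * B) i = d \<cdot>\<^sub>v row B j"
proof (rule eq_vecI)
  fix k assume "k < dim_vec (d \<cdot>\<^sub>v row B j)"
  then have "k < c" using B by simp
  then show "row (A * B) i $ k = (d \<cdot>\<^sub>v row B j) $ k"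
    using assms by simp
qed (use assms in simp)

text \<open>The parabolic is the stabilizer of the line spanned by the last unit row vector.
  Invertibility of both diagonal blocks follows from det p = det A * det D.\<close>

lemma parabolic_iff:
  fixes p :: "'k :: field mat"
  assumes N: "N > 0"
  shows "p \<in> parabolic (N - 1) 1 \<longleftrightarrow>
    p \<in> carrier (GL N) \<and> (\<exists>d. d \<noteq> 0 \<and> row p (N - 1) = d \<cdot>\<^sub>v unit_vec N (N - 1))"
proof
  assume "p \<in> parabolic (N - 1) 1"
  then obtain A X D where p: "p = four_block_mat A X (0\<^sub>m 1 (N - 1)) D"
    and A: "A \<in> carrier (GL (N - 1))" and X: "X \<in> carrier_mat (N - 1) 1"
    and D: "D \<in> carrier (GL 1)" unfolding parabolic_def by blast
  note c = GL_carrier_mat[OF A] X GL_carrier_mat[OF D]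
  have "det p = det A * det D"
    unfolding p using c by (intro det_four_block_mat_lower_left_zero) auto
  moreover have "p \<in> carrier_mat (N - 1 + 1) (N - 1 + 1)"
    unfolding p using c by (intro four_block_carrier_mat)
  ultimately have "p \<in> carrier (GL N)"
    using A D N by (simp add: carrier_GL_iff)
  moreover have "D $$ (0, 0) \<noteq> 0"
    using D det_single[of D] by (simp add: carrier_GL_iff)
  moreover have "row p (N - 1) = D $$ (0, 0) \<cdot>\<^sub>v unit_vec N (N - 1)"
    using N c unfolding p by (intro eq_vecI) auto
  ultimately show "p \<in> carrier (GL N) \<and> (\<exists>d. d \<noteq> 0 \<and> row p (N - 1) = d \<cdot>\<^sub>v unit_vec N (N - 1))"
    by blast
next
  assume "p \<in> carrier (GL N) \<and> (\<exists>d. d \<noteq> 0 \<and> row p (N - 1) = d \<cdot>\<^sub>v unit_vec N (N - 1))"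
  then obtain d where p: "p \<in> carrier (GL N)"
    and row: "row p (N - 1) = d \<cdot>\<^sub>v unit_vec N (N - 1)" by blast
  obtain A X Y D where split: "split_block p (N - 1) (N - 1) = (A, X, Y, D)" by (metis prod_cases4)
  have "dim_row p = N - 1 + 1" "dim_col p = N - 1 + 1"
    using N GL_carrier_mat[OF p] by auto
  from split_block[OF split this]
  have eq: "p = four_block_mat A X Y D" and c: "A \<in> carrier_mat (N - 1) (N - 1)"
    "X \<in> carrier_mat (N - 1) 1" "Y \<in> carrier_mat 1 (N - 1)" "D \<in> carrier_mat 1 1" by auto
  have "Y = 0\<^sub>m 1 (N - 1)"
  proof (rule eq_matI)
    fix i j assume ij: "i < dim_row (0\<^sub>m 1 (N - 1) :: 'k mat)" "j < dim_col (0\<^sub>m 1 (N - 1) :: 'k mat)"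
    then have "Y $$ (i, j) = row p (N - 1) $ j"
      using c N unfolding eq by auto
    then show "Y $$ (i, j) = 0\<^sub>m 1 (N - 1) $$ (i, j)"
      unfolding row using ij by simp
  qed (use c in auto)
  with eq have eq: "p = four_block_mat A X (0\<^sub>m 1 (N - 1)) D" by simp
  have "det p = det A * det D"
    unfolding eq using c by (intro det_four_block_mat_lower_left_zero) auto
  then have "A \<in> carrier (GL (N - 1))" "D \<in> carrier (GL 1)"
    using p c by (simp_all add: carrier_GL_iff)
  then show "p \<in> parabolic (N - 1) 1" unfolding parabolic_def using eq c by blast
qed

definition last_row_mat :: "nat \<Rightarrow> nat \<Rightarrow> 'k :: field mat \<Rightarrow> 'k mat" where
  "last_row_mat m n x = unflatten m n (row x (m * n - 1))"

lemma last_row_mat_carrier [simp]: "last_row_mat m n x \<in> carrier_mat m n"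
  by (simp add: last_row_mat_def)

lemma unflatten_inject:
  assumes "v \<in> carrier_vec (m * n)" "w \<in> carrier_vec (m * n)" "unflatten m n v = unflatten m n w"
  shows "v = w"
proof (rule eq_vecI)
  fix s assume "s < dim_vec w"
  then have s: "s < m * n" using assms by simp
  then have "n > 0" by (cases n) auto
  then have "s div n < m" "s mod n < n" using s by (simp_all add: less_mult_imp_div_less)
  moreover from this have "unflatten m n u $$ (s div n, s mod n) = u $ s" for u :: "'a vec"
    by (simp add: unflatten_def)
  ultimately show "v $ s = w $ s" using assms(3) by metis
qed (use assms in simp)

lemma unflatten_smult:
  "v \<in> carrier_vec (m * n) \<Longrightarrow> unflatten m n (d \<cdot>\<^sub>v v) = d \<cdot>\<^sub>m unflatten m n v"
  by (rule eq_matI) (auto simp: unflatten_def mult_add_less_mult)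

text \<open>The double coset is cut out by the orbit of the last row alone. Given an equivalence,
  choose t so that x t and y have the same last row; then y (x t)^(-1) fixes the last unit row
  vector and is the required parabolic element.\<close>

lemma mem_double_coset_iff:
  fixes x y :: "'k :: field mat"
  assumes mn: "m * n > 0" and x: "x \<in> carrier (GL (m * n))"
  shows "y \<in> double_coset (GL (m * n)) (parabolic (m * n - 1) 1) (kronecker_subgroup m n) x \<longleftrightarrow>
    y \<in> carrier (GL (m * n)) \<and> equivalent_mat m n (last_row_mat m n x) (last_row_mat m n y)"
proof -
  let ?N = "m * n" and ?D = "double_coset (GL (m * n)) (parabolic (m * n - 1) 1) (kronecker_subgroup m n) x"
  have D: "y \<in> ?D \<longleftrightarrow> (\<exists>p \<in> parabolic (?N - 1) 1. \<exists>h \<in> carrier (GL m). \<exists>g \<in> carrier (GL n).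
      y = p * x * kronecker h g)"
    unfolding double_coset_def r_coset_def set_mult_def kronecker_subgroup_def by auto
  note cx = GL_carrier_mat[OF x]
  have l: "?N - 1 < ?N" using mn by simp
  show ?thesis
  proof
    assume "y \<in> ?D"
    then obtain p h g where pp: "p \<in> parabolic (?N - 1) 1" and h: "h \<in> carrier (GL m)"
      and g: "g \<in> carrier (GL n)" and y: "y = p * x * kronecker h g" unfolding D by blast
    from pp obtain d where p: "p \<in> carrier (GL ?N)" and d: "d \<noteq> 0"
      and row: "row p (?N - 1) = d \<cdot>\<^sub>v unit_vec ?N (?N - 1)"
      unfolding parabolic_iff[OF mn] by blast
    note c = GL_carrier_mat[OF p] GL_carrier_mat[OF h] GL_carrier_mat[OF g]
    have "last_row_mat m n y = transpose_mat h * unflatten m n (row (p * x) (?N - 1)) * g"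
      unfolding last_row_mat_def y
      by (rule unflatten_row_mult_kronecker[where r = ?N]) (use c cx l in auto)
    also have "unflatten m n (row (p * x) (?N - 1)) = d \<cdot>\<^sub>m last_row_mat m n x"
      unfolding last_row_mat_def row_unit_mult[OF c(1) cx l l row]
      using cx l by (intro unflatten_smult) auto
    \<comment> \<open>The scalar coming from the parabolic is moved into the left factor, which
      stays invertible since \<open>d\<close> is nonzero.\<close>
    also have "transpose_mat h * (d \<cdot>\<^sub>m last_row_mat m n x) = (d \<cdot>\<^sub>m transpose_mat h) * last_row_mat m n x"
      using c by (simp add: mult_smult_assoc_mat[of _ m m _ n] mult_smult_distrib[of _ m m _ n])
    finally have "equivalent_mat m n (last_row_mat m n x) (last_row_mat m n y)"
      unfolding equivalent_mat_def using GL_smult[OF GL_transpose[OF h] d] g by blast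
    moreover have "y \<in> carrier (GL ?N)"
      unfolding y by (intro GL_mult kronecker_GL p x h g)
    ultimately show "y \<in> carrier (GL ?N) \<and> equivalent_mat m n (last_row_mat m n x) (last_row_mat m n y)"
      by blast
  next
    assume "y \<in> carrier (GL ?N) \<and> equivalent_mat m n (last_row_mat m n x) (last_row_mat m n y)"
    then obtain h g where y: "y \<in> carrier (GL ?N)" and h: "h \<in> carrier (GL m)"
      and g: "g \<in> carrier (GL n)" and eq: "last_row_mat m n y = h * last_row_mat m n x * g"
      unfolding equivalent_mat_def by blast
    let ?t = "kronecker (transpose_mat h) g"
    have t: "?t \<in> carrier (GL ?N)" by (intro kronecker_GL GL_transpose h g)
    note xt = GL_mult[OF x t]
    obtain z where z: "z \<in> carrier (GL ?N)" "x * ?t * z = 1\<^sub>m ?N" "z * (x * ?t) = 1\<^sub>m ?N"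
      using GL_inverse[OF xt] by metis
    note c = GL_carrier_mat[OF y] GL_carrier_mat[OF h] GL_carrier_mat[OF g] GL_carrier_mat[OF t]
      GL_carrier_mat[OF z(1)] GL_carrier_mat[OF xt]
    have "unflatten m n (row (x * ?t) (?N - 1)) = unflatten m n (row y (?N - 1))"
      using unflatten_row_mult_kronecker[OF cx _ c(3) l, of "transpose_mat h"] c eq
      by (simp add: last_row_mat_def)
    then have row: "row (x * ?t) (?N - 1) = row y (?N - 1)"
      using c l by (intro unflatten_inject[of _ m n]) auto
    let ?p = "y * z"
    \<comment> \<open>A row of a product depends only on that row of the left factor, so
      \<open>y\<close> may be replaced by x t, whose product with \<open>z\<close> is the
      identity.\<close>
    have "row ?p (?N - 1) = row (x * ?t * z) (?N - 1)"
      using c l row by (intro eq_vecI) auto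
    then have "row ?p (?N - 1) = 1 \<cdot>\<^sub>v unit_vec ?N (?N - 1)"
      using l by (simp add: z(2))
    then have "?p \<in> parabolic (?N - 1) 1"
      unfolding parabolic_iff[OF mn] using GL_mult[OF y z(1)] zero_neq_one by metis
    moreover have "y = ?p * x * ?t"
      using c cx z(3) by (simp add: assoc_mult_mat[of _ ?N ?N _ ?N _ ?N])
    ultimately show "y \<in> ?D" unfolding D using GL_transpose[OF h] g by blast
  qed
qed

lemma last_row_mat_nonzero:
  fixes x :: "'k :: field mat"
  assumes mn: "m * n > 0" and x: "x \<in> carrier (GL (m * n))"
  shows "last_row_mat m n x \<noteq> 0\<^sub>m m n"
proof
  let ?N = "m * n"
  assume "last_row_mat m n x = 0\<^sub>m m n"
  also have "0\<^sub>m m n = unflatten m n (0\<^sub>v ?N)"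
    by (rule eq_matI) (auto simp: unflatten_def mult_add_less_mult)
  finally have row: "row x (?N - 1) = 0\<^sub>v ?N"
    unfolding last_row_mat_def
    by (rule unflatten_inject[rotated 2]) (use GL_carrier_mat[OF x] in \<open>auto intro!: carrier_vecI\<close>)
  obtain z where z: "z \<in> carrier (GL ?N)" "x * z = 1\<^sub>m ?N" using GL_inverse[OF x] by metis
  have "col z (?N - 1) \<in> carrier_vec ?N"
    using GL_carrier_mat[OF z(1)] by (auto intro!: carrier_vecI)
  then have "(x * z) $$ (?N - 1, ?N - 1) = 0"
    using row mn GL_carrier_mat[OF x] GL_carrier_mat[OF z(1)] by simp
  then show False using mn by (simp add: z(2))
qed

section \<open>The representatives\<close>

lemma eps_properties:
  fixes m n r :: nat
  assumes r: "r < n" and n: "n \<le> m"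
  shows "(eps m n r :: 'k :: field mat) \<in> carrier (GL (m * n))" (is ?carrier)
    and "last_row_mat m n (eps m n r :: 'k mat) =
      mat m n (\<lambda>(i, j). if i + j + r + 2 = m + n then 1 else 0)" (is ?last)
proof -
  define a c where "a = (m - r) * n - 1" and "c = r * n"
  let ?Q = "four_block_mat (0\<^sub>m c 1) (1\<^sub>m c) (1\<^sub>m 1) (0\<^sub>m 1 c) :: 'k mat"
  let ?Q' = "four_block_mat (0\<^sub>m 1 c) (1\<^sub>m 1) (1\<^sub>m c) (0\<^sub>m c 1) :: 'k mat"
  let ?U = "four_block_mat (1\<^sub>m 1) (b_row n r) (0\<^sub>m c 1) (1\<^sub>m c) :: 'k mat"
  let ?ext = "\<lambda>B. four_block_mat (1\<^sub>m a) (0\<^sub>m a (1 + c)) (0\<^sub>m (1 + c) a) B :: 'k mat"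
  have eps: "eps m n r = ?ext ?Q * ?ext ?U"
    unfolding eps_def Let_def a_def c_def ..
  have pos: "(m - r) * n > 0" using assms by simp
  have split: "(m - r) * n + r * n = m * n"
    using assms by (simp flip: add_mult_distrib)
  have N: "a + (1 + c) = m * n" using pos split unfolding a_def c_def by linarith
  have b: "b_row n r \<in> carrier_mat 1 c" by (simp add: b_row_def c_def)
  have "?Q * ?Q' = 1\<^sub>m (c + 1)"
    by (subst mult_four_block_mat[of _ c 1 _ c _ 1 _ _ c _ 1]) auto
  moreover have "?Q \<in> carrier_mat (1 + c) (1 + c)" "?Q' \<in> carrier_mat (1 + c) (1 + c)"
    by (auto simp: add.commute)
  ultimately have Q: "?Q \<in> carrier (GL (1 + c))"
    using GL_of_right_inverse(1)[of ?Q "1 + c" ?Q'] by (simp add: add.commute)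
  have "det ?U = 1"
    using det_four_block_mat_lower_left_zero[OF one_carrier_mat b refl one_carrier_mat] by simp
  moreover have "?U \<in> carrier_mat (1 + c) (1 + c)" by auto
  ultimately have U: "?U \<in> carrier (GL (1 + c))" by (simp add: carrier_GL_iff)
  have eQ: "?ext ?Q \<in> carrier (GL (m * n))"
    using GL_block_diag[OF GL_one Q, of a] by (simp only: N)
  have eU: "?ext ?U \<in> carrier (GL (m * n))"
    using GL_block_diag[OF GL_one U, of a] by (simp only: N)
  show ?carrier unfolding eps by (rule GL_mult[OF eQ eU])
  have last: "m * n - 1 = a + c" using N by simp
  have aN: "a < m * n" "a + c < m * n" using N by auto
  \<comment> \<open>The permutation factor puts row \<open>a\<close> of the unipotent factor, the
    one containing \<open>b_row n r\<close>, at the bottom.\<close>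
  have "row (?ext ?Q) (a + c) = 1 \<cdot>\<^sub>v unit_vec (m * n) a"
    using N by (intro eq_vecI) auto
  from row_unit_mult[OF GL_carrier_mat[OF eQ] GL_carrier_mat[OF eU] aN(2,1) this]
  have row: "row (eps m n r :: 'k mat) (m * n - 1) = row (?ext ?U) a"
    unfolding last eps by simp
  have entry: "row (?ext ?U) a $ s =
      (if s < a then 0 else if s = a then 1 else b_row n r $$ (0, s - a - 1))"
    if "s < m * n" for s
    using that N b by (auto simp: c_def)
  show ?last
  proof (rule eq_matI)
    fix i j assume "i < dim_row (mat m n (\<lambda>(i, j). if i + j + r + 2 = m + n then 1 else (0 :: 'k)))"
      "j < dim_col (mat m n (\<lambda>(i, j). if i + j + r + 2 = m + n then 1 else (0 :: 'k)))"
    then have i: "i < m" and j: "j < n" by auto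
    let ?s = "i * n + j"
    have s: "?s < m * n" using i j by (simp add: mult_add_less_mult)
    have lhs: "last_row_mat m n (eps m n r :: 'k mat) $$ (i, j) =
        (if ?s < a then 0 else if ?s = a then 1 else b_row n r $$ (0, ?s - a - 1))"
      unfolding last_row_mat_def row using i j entry[OF s] by (simp add: unflatten_def)
    have "\<dots> = (if i + j + r + 2 = m + n then 1 else 0)"
    \<comment> \<open>Rows with i < m - r end no later than position \<open>a\<close> and can only
      meet the single 1; the rows below are the blocks of \<open>b_row n r\<close>.\<close>
    proof (cases "i < m - r")
      case True
      then obtain t where t: "m - r = i + 1 + t" using less_iff_Suc_add by auto
      \<comment> \<open>Both n - j \<ge> 1 and t * n \<ge> 0, so position \<open>a\<close> is hit
        only for t = 0 and j = n - 1.\<close>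
      have a: "a + 1 = ?s + (n - j) + t * n"
        using pos j by (simp add: a_def t algebra_simps)
      have "?s = a \<longleftrightarrow> i + j + r + 2 = m + n"
      proof
        assume "?s = a"
        with a j have "n - j + t * n = 1" by simp
        with j have "t = 0" "n - j = 1" by (cases t; simp)+
        with t r n show "i + j + r + 2 = m + n" by simp
      next
        assume "i + j + r + 2 = m + n"
        with t r n j have "t = 0" "n - j = 1" by simp_all
        with a show "?s = a" by simp
      qed
      moreover have "?s \<le> a" using a j by linarith
      ultimately show ?thesis by auto
    next
      case False
      define t where "t = i - (m - r)"
      have t: "i = m - r + t" using False by (simp add: t_def)
      have tr: "t < r" using t i r n by simp
      have "i * n = (m - r) * n + t * n" by (simp add: t add_mult_distrib)
      then have a: "?s = a + 1 + (t * n + j)"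
        using pos unfolding a_def by linarith
      have "t * n + j < c" using tr j by (simp add: c_def mult_add_less_mult)
      \<comment> \<open>Block \<open>t\<close> is e_(n-(t+1))^T, whose 1 sits in column n - (t + 1)
        - 1 counted from 0. As t < r < n, no subtraction is truncated.\<close>
      then have "b_row n r $$ (0, t * n + j) = (if j = n - (t + 1) - 1 then 1 else (0 :: 'k))"
        using j tr r by (simp add: b_row_def c_def)
      moreover have "j = n - (t + 1) - 1 \<longleftrightarrow> i + j + r + 2 = m + n"
        using t tr r n by auto
      ultimately show ?thesis using a by simp
    qed
    then show "last_row_mat m n (eps m n r :: 'k mat) $$ (i, j) =
        mat m n (\<lambda>(i, j). if i + j + r + 2 = m + n then 1 else 0) $$ (i, j)"
      using i j lhs by simp
  qed (simp_all add: last_row_mat_def unflatten_def)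
qed

text \<open>The \<open>k\<close> ones stand at (m-k+t, n-1-t) for t < k. Rotating the last
  \<open>k\<close> rows to the top and reversing the columns moves them to (t, t).\<close>

lemma equivalent_antidiagonal_rank_mat:
  assumes "k \<le> m" "k \<le> n"
  shows "equivalent_mat m n (mat m n (\<lambda>(i, j). if i + j + k + 1 = m + n then 1 else 0))
    (rank_mat m n k :: 'k :: field mat)"
proof -
  let ?p = "\<lambda>i. if i < m - k then i + k else if i < m then i - (m - k) else i"
  let ?q = "\<lambda>j. if j < n then n - 1 - j else j"
  have "bij_betw ?p {0..<m} {0..<m}"
    by (rule bij_betw_byWitness[where f' = "\<lambda>i. if i < k then i + (m - k) else i - k"])
      (use assms in auto)
  then have p: "?p permutes {0..<m}" by (rule bij_imp_permutes) auto
  have "bij_betw ?q {0..<n} {0..<n}"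
    by (rule bij_betw_byWitness[where f' = "\<lambda>j. n - 1 - j"]) auto
  then have q: "?q permutes {0..<n}" by (rule bij_imp_permutes) auto
  have eq: "mat m n (\<lambda>(i, j). rank_mat m n k $$ (?p i, ?q j)) =
      mat m n (\<lambda>(i, j). if i + j + k + 1 = m + n then 1 else (0 :: 'k))"
  proof (rule eq_matI)
    fix i j
    assume "i < dim_row (mat m n (\<lambda>(i, j). if i + j + k + 1 = m + n then 1 else (0 :: 'k)))"
      "j < dim_col (mat m n (\<lambda>(i, j). if i + j + k + 1 = m + n then 1 else (0 :: 'k)))"
    then have ij: "i < m" "j < n" by auto
    then have "?p i < m" "?q j < n" using assms by auto
    moreover have "?p i = ?q j \<and> ?p i < k \<longleftrightarrow> i + j + k + 1 = m + n"
    proof (cases "i < m - k")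
      case True
      then have "i + j + k + 1 \<noteq> m + n" using ij by linarith
      with True show ?thesis by simp
    next
      case False
      then obtain t where t: "i = (m - k) + t" "t < k" using ij assms
        by (metis le_add_diff_inverse2 less_diff_conv2 linorder_not_less le_add_diff_inverse)
      have "t = n - 1 - j \<longleftrightarrow> (m - k) + t + j + k + 1 = m + n"
        using ij assms by linarith
      with False ij t show ?thesis by simp
    qed
    ultimately show "mat m n (\<lambda>(i, j). rank_mat m n k $$ (?p i, ?q j)) $$ (i, j) =
        mat m n (\<lambda>(i, j). if i + j + k + 1 = m + n then 1 else (0 :: 'k)) $$ (i, j)"
      using ij by (simp add: rank_mat_def split del: if_split)
  qed simp_all
  have "equivalent_mat m n (rank_mat m n k)
      (mat m n (\<lambda>(i, j). if i + j + k + 1 = m + n then 1 else (0 :: 'k)))"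
    using equivalent_mat_permute[where ?'k = 'k, OF rank_mat_carrier[of m n k] p q] unfolding eq .
  then show ?thesis by (rule equivalent_mat_sym[OF rank_mat_carrier])
qed

lemma equivalent_eps_rank_mat:
  assumes "r < n" "n \<le> m"
  shows "equivalent_mat m n (last_row_mat m n (eps m n r)) (rank_mat m n (r + 1) :: 'k :: field mat)"
  using equivalent_antidiagonal_rank_mat[of "r + 1" m n] assms by (simp add: eps_properties(2))

text \<open>If the last row of \<open>x\<close> gives a matrix equivalent to
  \<open>rank_mat m n k\<close>, then 1 \<le> k \<le> n, and r = k - 1 is the only index whose
  representative has the same normal form.\<close>

lemma ex1_eps:
  fixes x :: "'k :: field mat"
  assumes n: "n \<ge> 1" "n \<le> m" and x: "x \<in> carrier (GL (m * n))"
  shows "\<exists>!r. r \<in> {0..n - 1} \<and> eps m n r \<in>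
    double_coset (GL (m * n)) (parabolic (m * n - 1) 1) (kronecker_subgroup m n) x"
proof -
  have mn: "m * n > 0" using n by simp
  let ?M = "last_row_mat m n x"
  have M: "?M \<in> carrier_mat m n" by simp
  obtain k where k: "k \<le> min m n" and Mk: "equivalent_mat m n ?M (rank_mat m n k)"
    using equivalent_rank_mat[OF M] by blast
  have "k \<noteq> 0"
  proof
    assume "k = 0"
    then have "equivalent_mat m n (0\<^sub>m m n) ?M"
      using equivalent_mat_sym[OF M Mk] by (simp add: rank_mat_0)
    then obtain h g where "h \<in> carrier (GL m)" "g \<in> carrier (GL n)"
      and "?M = h * 0\<^sub>m m n * g" unfolding equivalent_mat_def by blast
    then have "?M = 0\<^sub>m m n"
      using GL_carrier_mat[of h m] GL_carrier_mat[of g n] by simp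
    with last_row_mat_nonzero[OF mn x] show False ..
  qed
  have iff: "r \<in> {0..n - 1} \<and> eps m n r \<in>
      double_coset (GL (m * n)) (parabolic (m * n - 1) 1) (kronecker_subgroup m n) x \<longleftrightarrow> r = k - 1" for r
  proof (cases "r < n")
    case True
    note eps_r = equivalent_eps_rank_mat[OF True n(2), where ?'k = 'k]
    have "eps m n r \<in> double_coset (GL (m * n)) (parabolic (m * n - 1) 1) (kronecker_subgroup m n) x \<longleftrightarrow>
        equivalent_mat m n ?M (last_row_mat m n (eps m n r))"
      using mem_double_coset_iff[OF mn x] eps_properties(1)[OF True n(2)] by blast
    also have "\<dots> \<longleftrightarrow> equivalent_mat m n ?M (rank_mat m n (r + 1))"
      using equivalent_mat_trans equivalent_mat_sym eps_r M last_row_mat_carrier rank_mat_carrier by metis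
    also have "\<dots> \<longleftrightarrow> r = k - 1"
      using equivalent_rank_mat_unique[OF M k _ Mk, of "r + 1"] Mk True n \<open>k \<noteq> 0\<close> by auto
    finally show ?thesis using True by auto
  next
    case False
    then show ?thesis using k \<open>k \<noteq> 0\<close> n by auto
  qed
  then show ?thesis unfolding iff by simp
qed

theorem theorem2p1:
  fixes m n :: nat
  defines "G \<equiv> (GL (m * n) :: 'k :: field_char_0 mat monoid)"
    and "P \<equiv> parabolic (m * n - 1) 1"
    and "T \<equiv> kronecker_subgroup m n"
  assumes "number_field TYPE('k)"
    and "n \<ge> 1" and "m \<ge> n"
  shows "card (double_cosets G P T) = n
    \<and> eps m n ` {0..n - 1} \<subseteq> carrier G
    \<and> (\<forall>D \<in> double_cosets G P T. \<exists>!r. r \<in> {0..n - 1} \<and> eps m n r \<in> D)"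
proof -
  have mn: "m * n > 0" using assms by simp
  have eps: "eps m n r \<in> carrier G" if "r \<in> {0..n - 1}" for r
    unfolding G_def using that assms by (intro eps_properties(1)) auto
  have ex1: "\<exists>!r. r \<in> {0..n - 1} \<and> eps m n r \<in> double_coset G P T x" if "x \<in> carrier G" for x
    using ex1_eps[of n m x] that assms unfolding G_def P_def T_def by blast
  have mem: "y \<in> double_coset G P T x \<longleftrightarrow>
      y \<in> carrier G \<and> equivalent_mat m n (last_row_mat m n x) (last_row_mat m n y)"
    if "x \<in> carrier G" for x y
    using mem_double_coset_iff[OF mn] that unfolding G_def P_def T_def by blast
  have self: "x \<in> double_coset G P T x" if "x \<in> carrier G" for x
    using that by (simp add: mem equivalent_mat_refl)
  \<comment> \<open>That a double coset is determined by any of its members is drawn from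
    \<open>equivalent_mat\<close> being symmetric and transitive, via the membership
    criterion.\<close>
  have cong: "double_coset G P T y = double_coset G P T x"
    if x: "x \<in> carrier G" and y: "y \<in> double_coset G P T x" for x y
  proof -
    have yG: "y \<in> carrier G" using mem x y by blast
    have "equivalent_mat m n (last_row_mat m n x) (last_row_mat m n y)" using mem x y by blast
    moreover from this have "equivalent_mat m n (last_row_mat m n y) (last_row_mat m n x)"
      by (rule equivalent_mat_sym[OF last_row_mat_carrier])
    ultimately show ?thesis
      using equivalent_mat_trans[OF last_row_mat_carrier] mem[OF x] mem[OF yG] by blast
  qed
  have "bij_betw (\<lambda>r. double_coset G P T (eps m n r)) {0..n - 1} (double_cosets G P T)"
  proof (rule bij_betwI')
    fix r s assume rs: "r \<in> {0..n - 1}" "s \<in> {0..n - 1}"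
    show "double_coset G P T (eps m n r) = double_coset G P T (eps m n s) \<longleftrightarrow> r = s"
      \<comment> \<open>Equal double cosets contain both representatives, so uniqueness of the index
        forces r = s.\<close>
      using ex1[OF eps[OF rs(1)]] self[OF eps[OF rs(1)]] self[OF eps[OF rs(2)]] rs by metis
  next
    fix r assume "r \<in> {0..n - 1}"
    then show "double_coset G P T (eps m n r) \<in> double_cosets G P T"
      using eps by (simp add: double_cosets_def)
  next
    fix D assume "D \<in> double_cosets G P T"
    then obtain x where x: "x \<in> carrier G" "D = double_coset G P T x"
      by (auto simp: double_cosets_def)
    then show "\<exists>r \<in> {0..n - 1}. D = double_coset G P T (eps m n r)"
      using ex1[OF x(1)] cong[OF x(1)] by blast
  qed
  then have "card (double_cosets G P T) = n"
    \<comment> \<open>Here n \<ge> 1 matters: only then does {0..n - 1} have n elements.\<close>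
    using bij_betw_same_card assms(5) by fastforce
  moreover have "eps m n ` {0..n - 1} \<subseteq> carrier G" using eps by blast
  moreover have "\<forall>D \<in> double_cosets G P T. \<exists>!r. r \<in> {0..n - 1} \<and> eps m n r \<in> D"
    using ex1 by (auto simp: double_cosets_def)
  ultimately show ?thesis by blast
qed

end
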